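(* Let $\mathcal{U}\subset\mathbb{R}^2$ be open and let $h_{\Re},h_{\Im}:\mathcal{U}\to\mathbb{R}$ satisfy the Cauchy–Riemann equations $\partial_x h_{\Re}=\partial_y h_{\Im}$, $\partial_y h_{\Re}=-\partial_x h_{\Im}$, so that $h(x,y)=h_{\Re}(x,y)+i\,h_{\Im}(x,y)$ is a holomorphic function of $z=x+iy$. On $$\mathcal{H}_{\mathrm{KN}}=\left\{(x,\varPhi,y,\varPsi)\in\mathbb{R}^4 : (x,y)\in\mathcal{U},\ \varPhi+i\varPsi\neq0,\ h(x,y)\neq(\varPhi+i\varPsi)^2\right\}$$ consider the pseudo-Riemannian metric $$\hat{\mathbf g}_h=\frac{\Delta_-\left[\Delta_+^2+h_{\Re}^2-h_{\Im}^2\right]+4\varPhi\varPsi h_{\Re}h_{\Im}-2\Delta_+^2h_{\Re}}{\Delta_+^2}\left(dx^2-dy^2\right)$$ $$-\,4\,\frac{\left[\varPhi h_{\Im}-\varPsi(\Delta_++h_{\Re})\right]\left[\varPsi h_{\Im}-\varPhi(\Delta_+-h_{\Re})\right]}{\Delta_+^2}\,dx\,dy+\frac{\Delta_-\left(d\varPhi^2-d\varPsi^2\right)+4\varPhi\varPsi\,d\varPhi\,d\varPsi}{\Delta_+^2},$$ where $\Delta_\pm=\varPhi^2\pm\varPsi^2$ and $h_{\Re/\Im}=h_{\Re/\Im}(x,y)$. Then $\hat{\mathbf g}_h$ is Einstein with constant $\eta=-2$. Therefore, its Ricci scalar is equal to $-8$.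
   Context: A metric $g$ is Einstein with constant $\eta\in\mathbb{R}$ if its Ricci tensor $R$ satisfies $R=\eta g$. Curvature conventions: $R^i{}_{jkl}=\Gamma^i_{jl,k}-\Gamma^i_{jk,l}+\Gamma^i_{mk}\Gamma^m_{jl}-\Gamma^i_{ml}\Gamma^m_{jk}$ and Ricci tensor $R_{ij}=R^k{}_{ikj}$. The metric $\hat{\mathbf g}_h$ is the real (Kähler–Norden) metric $\mathrm{Re}\,G_h$, where $G_h=\mathfrak{X}^{-2}\left[(h(z)-\mathfrak{X}^2)^2dz^2+d\mathfrak{X}^2\right]$, $z=x+iy$, $\mathfrak{X}=\varPhi+i\varPsi$. *)

theory Defs
  imports "HOL-Analysis.Analysis"
begin

definition pdiff :: "'n::finite \<Rightarrow> (real^'n \<Rightarrow> real) \<Rightarrow> real^'n \<Rightarrow> real" where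
  "pdiff k f p = deriv (\<lambda>t. f (p + t *\<^sub>R axis k 1)) 0"

text \<open>\<open>S\<close> is meant to be open in the following two definitions.\<close>

primrec Ck_on :: "nat \<Rightarrow> (real^'n::finite) set \<Rightarrow> (real^'n \<Rightarrow> real) \<Rightarrow> bool" where
  "Ck_on 0 S f \<longleftrightarrow> continuous_on S f"
| "Ck_on (Suc k) S f \<longleftrightarrow> f differentiable_on S \<and> (\<forall>i. Ck_on k S (pdiff i f))"

definition smooth_on :: "(real^'n::finite) set \<Rightarrow> (real^'n \<Rightarrow> real) \<Rightarrow> bool" where
  "smooth_on S f \<longleftrightarrow> (\<forall>k. Ck_on k S f)"

text \<open>A metric is given by its component matrix \<open>g p $ i $ j\<close> in the standard coordinates.
  No signature condition is imposed; nondegeneracy and continuity make the signature locally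
  constant.\<close>

definition pseudo_riemannian_metric_on ::
    "(real^'n::finite) set \<Rightarrow> (real^'n \<Rightarrow> real^'n^'n) \<Rightarrow> bool" where
  "pseudo_riemannian_metric_on S g \<longleftrightarrow>
     open S \<and> (\<forall>i j. smooth_on S (\<lambda>p. g p $ i $ j)) \<and>
     (\<forall>p\<in>S. transpose (g p) = g p \<and> invertible (g p))"

text \<open>\<open>christoffel g i j k\<close> is \<open>\<Gamma>\<close> with upper index \<open>i\<close> and lower indices \<open>j k\<close>.\<close>

definition christoffel ::
    "(real^'n::finite \<Rightarrow> real^'n^'n) \<Rightarrow> 'n \<Rightarrow> 'n \<Rightarrow> 'n \<Rightarrow> real^'n \<Rightarrow> real" where
  "christoffel g i j k p =
     (1/2) * (\<Sum>l\<in>UNIV. matrix_inv (g p) $ i $ l *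
        (pdiff j (\<lambda>q. g q $ l $ k) p + pdiff k (\<lambda>q. g q $ l $ j) p
          - pdiff l (\<lambda>q. g q $ j $ k) p))"

text \<open>Upper index \<open>i\<close>, lower indices \<open>j k l\<close>. With the contraction used for the Ricci tensor
  below, round spheres have positive Ricci curvature.\<close>

definition riemann ::
    "(real^'n::finite \<Rightarrow> real^'n^'n) \<Rightarrow> 'n \<Rightarrow> 'n \<Rightarrow> 'n \<Rightarrow> 'n \<Rightarrow> real^'n \<Rightarrow> real" where
  "riemann g i j k l p =
     pdiff k (christoffel g i j l) p - pdiff l (christoffel g i j k) p
     + (\<Sum>m\<in>UNIV. christoffel g i m k p * christoffel g m j l p)
     - (\<Sum>m\<in>UNIV. christoffel g i m l p * christoffel g m j k p)"

definition ricci :: "(real^'n::finite \<Rightarrow> real^'n^'n) \<Rightarrow> real^'n \<Rightarrow> real^'n^'n" where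
  "ricci g p = (\<chi> i j. \<Sum>k\<in>UNIV. riemann g k i k j p)"

definition ricci_scalar :: "(real^'n::finite \<Rightarrow> real^'n^'n) \<Rightarrow> real^'n \<Rightarrow> real" where
  "ricci_scalar g p = (\<Sum>i\<in>UNIV. \<Sum>j\<in>UNIV. matrix_inv (g p) $ i $ j * ricci g p $ i $ j)"

definition einstein_on ::
    "(real^'n::finite) set \<Rightarrow> (real^'n \<Rightarrow> real^'n^'n) \<Rightarrow> real \<Rightarrow> bool" where
  "einstein_on S g \<eta> \<longleftrightarrow>
     pseudo_riemannian_metric_on S g \<and> (\<forall>p\<in>S. ricci g p = \<eta> *\<^sub>R g p)"

text \<open>The symmetric product of covectors is normalised so that \<open>\<alpha> \<odot> \<alpha>\<close> is the square of
  \<open>\<alpha>\<close> as a quadratic form; thus \<open>dx dy\<close> contributes 1/2 to each of the two off-diagonal entries.\<close>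

definition symprod :: "real^'n::finite \<Rightarrow> real^'n \<Rightarrow> real^'n^'n" (infixl "\<odot>" 75) where
  "\<alpha> \<odot> \<beta> = (\<chi> i j. (\<alpha> $ i * \<beta> $ j + \<alpha> $ j * \<beta> $ i) / 2)"

text \<open>Points of \<open>\<real>\<^sup>4\<close> are \<open>(x, \<Phi>, y, \<Psi>)\<close>, in this order.\<close>

definition base_point :: "real^4 \<Rightarrow> real^2" where
  "base_point p = vector [p $ 1, p $ 3]"

definition H_KN :: "(real^2) set \<Rightarrow> (real^2 \<Rightarrow> real) \<Rightarrow> (real^2 \<Rightarrow> real) \<Rightarrow> (real^4) set" where
  "H_KN U hRe hIm =
     {p. base_point p \<in> U \<and> Complex (p $ 2) (p $ 4) \<noteq> 0 \<and>
         Complex (hRe (base_point p)) (hIm (base_point p)) \<noteq> (Complex (p $ 2) (p $ 4))^2}"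

definition g_KN :: "(real^2 \<Rightarrow> real) \<Rightarrow> (real^2 \<Rightarrow> real) \<Rightarrow> real^4 \<Rightarrow> real^4^4" where
  "g_KN hRe hIm p =
    (let \<Phi> = p $ 2; \<Psi> = p $ 4;
         hr = hRe (base_point p); hi = hIm (base_point p);
         Dp = \<Phi>^2 + \<Psi>^2; Dm = \<Phi>^2 - \<Psi>^2;
         dx = axis 1 1; d\<Phi> = axis 2 1; dy = axis 3 1; d\<Psi> = axis 4 1
     in ((Dm * (Dp^2 + hr^2 - hi^2) + 4 * \<Phi> * \<Psi> * hr * hi - 2 * Dp^2 * hr) / Dp^2)
          *\<^sub>R (dx \<odot> dx - dy \<odot> dy)
        - (4 * ((\<Phi> * hi - \<Psi> * (Dp + hr)) * (\<Psi> * hi - \<Phi> * (Dp - hr))) / Dp^2)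
          *\<^sub>R (dx \<odot> dy)
        + (1 / Dp^2)
          *\<^sub>R (Dm *\<^sub>R (d\<Phi> \<odot> d\<Phi> - d\<Psi> \<odot> d\<Psi>) + (4 * \<Phi> * \<Psi>) *\<^sub>R (d\<Phi> \<odot> d\<Psi>)))"

end

theory Submission
  imports Defs "HOL-Complex_Analysis.Cauchy_Integral_Formula"
begin

text \<open>The metric is \<open>Re G\<close> for the holomorphic metric \<open>G = (h/X - X)\<^sup>2 dz\<^sup>2 + dX\<^sup>2/X\<^sup>2\<close> on a complex
  surface. For any such real part, the real Christoffel symbols and curvature components are the
  real parts of the complex ones, and each complex direction contributes twice to the trace that
  defines the Ricci tensor, so \<open>Ric (Re G) = 2 Re (Ric G)\<close>. With \<open>X = exp s\<close> one has
  \<open>G = w\<^sup>2 dz\<^sup>2 + ds\<^sup>2\<close> where \<open>w = h exp (-s) - exp s\<close> satisfies \<open>w\<^sub>s\<^sub>s = w\<close>; hence \<open>G\<close> has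
  curvature \<open>-1\<close> and \<open>Ric G = -G\<close>.\<close>

section \<open>Complex coordinates on R^4 and the contraction of indices\<close>

text \<open>The real coordinate \<open>i\<close> of \<open>(x, \<Phi>, y, \<Psi>)\<close> belongs to the complex coordinate
  \<open>cplx_index i\<close>, where 1 stands for \<open>z\<close> and 2 for \<open>X\<close>, and its coordinate vector is \<open>cplx_unit i\<close>
  times the complex one.\<close>

definition cplx_index :: "4 \<Rightarrow> 2" where
  "cplx_index i = (if i = 1 \<or> i = 3 then 1 else 2)"

definition cplx_unit :: "4 \<Rightarrow> complex" where
  "cplx_unit i = (if i = 1 \<or> i = 2 then 1 else \<i>)"

definition cplx_coord :: "2 \<Rightarrow> real^4 \<Rightarrow> complex" where
  "cplx_coord a p = (if a = 1 then Complex (p $ 1) (p $ 3) else Complex (p $ 2) (p $ 4))"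

text \<open>\<open>D a\<close> is the complex partial derivative in the direction \<open>a\<close>.\<close>

definition has_cderiv :: "(real^4 \<Rightarrow> complex) \<Rightarrow> (2 \<Rightarrow> complex) \<Rightarrow> real^4 \<Rightarrow> bool" where
  "has_cderiv F D p \<longleftrightarrow> (F has_derivative (\<lambda>v. \<Sum>a\<in>UNIV. D a * cplx_coord a v)) (at p)"

lemma cplx_simps [simp]:
  "cplx_index 1 = 1" "cplx_index 2 = 2" "cplx_index 3 = 1" "cplx_index 4 = 2"
  "cplx_unit 1 = 1" "cplx_unit 2 = 1" "cplx_unit 3 = \<i>" "cplx_unit 4 = \<i>"
  by (simp_all add: cplx_index_def cplx_unit_def)

lemma cplx_coord_axis: "cplx_coord a (axis k 1) = (if a = cplx_index k then cplx_unit k else 0)"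
  using exhaust_2[of a] exhaust_4[of k]
  by (auto simp: cplx_coord_def axis_def complex_eq_iff)

lemma bounded_linear_cplx_coord: "bounded_linear (cplx_coord a)"
  unfolding cplx_coord_def[abs_def]
  by (intro linear_conv_bounded_linear[THEN iffD1] linearI) (auto simp: complex_eq_iff)

text \<open>Each complex index occurs with exactly the two units 1 and \<open>\<i>\<close>, so a sum
  over the four real indices falls into pairs.\<close>

lemma sum_index_pairs:
  fixes f :: "2 \<Rightarrow> complex \<Rightarrow> 'b::comm_monoid_add"
  shows "(\<Sum>m\<in>UNIV. f (cplx_index m) (cplx_unit m)) = (\<Sum>a\<in>UNIV. f a 1 + f a \<i>)"
  by (simp add: sum_4 sum_2 add_ac)

text \<open>For each complex index the two summands are Re P Re Q and Re (iP) Re (-iQ) = - Im P Im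
  Q, which add up to Re (P Q). Lower indices carry units and upper ones their conjugates, so every
  real contraction below becomes a complex one under \<open>Re\<close>.\<close>

lemma Re_contract:
  "(\<Sum>m\<in>UNIV. Re (P (cplx_index m) * cplx_unit m) * Re (cnj (cplx_unit m) * Q (cplx_index m)))
    = Re (\<Sum>a\<in>UNIV. P a * Q a)"
  unfolding sum_index_pairs[of "\<lambda>a u. Re (P a * u) * Re (cnj u * Q a)"] by simp

section \<open>Partial derivatives and smoothness as local notions\<close>

lemma pdiff_eqI:
  assumes "(f has_derivative f') (at p)"
  shows "pdiff k f p = f' (axis k 1)"
proof -
  have l: "((\<lambda>t. p + t *\<^sub>R axis k (1::real)) has_derivative (\<lambda>t. t *\<^sub>R axis k 1)) (at 0)"
    by (auto intro!: derivative_eq_intros)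
  have "((\<lambda>t. f (p + t *\<^sub>R axis k 1)) has_derivative (\<lambda>t. f' (t *\<^sub>R axis k 1))) (at 0)"
    using has_derivative_compose[OF l, of f f'] assms by simp
  moreover have "(\<lambda>t. f' (t *\<^sub>R axis k 1)) = (*) (f' (axis k 1))"
    using linear_cmul[OF has_derivative_linear[OF assms]] by (auto simp: mult.commute)
  ultimately show ?thesis
    unfolding pdiff_def by (intro DERIV_imp_deriv) (simp add: has_field_derivative_def)
qed

text \<open>As \<open>S\<close> is open, the line through \<open>p\<close> stays in \<open>S\<close>
  for all small t, and the derivative at t = 0 depends only on those values.\<close>

lemma pdiff_cong:
  assumes "open S" "p \<in> S" "\<And>q. q \<in> S \<Longrightarrow> f q = g q"
  shows "pdiff k f p = pdiff k g p"
proof -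
  have "((\<lambda>t. p + t *\<^sub>R axis k (1::real)) \<longlongrightarrow> p + 0 *\<^sub>R axis k 1) (nhds 0)"
    by (intro tendsto_intros filterlim_ident)
  then have "eventually (\<lambda>t. p + t *\<^sub>R axis k 1 \<in> S) (nhds 0)"
    using assms(1,2) by (simp add: topological_tendstoD)
  then show ?thesis
    unfolding pdiff_def by (intro deriv_cong_ev) (auto elim!: eventually_mono simp: assms(3))
qed

text \<open>The recursion passes to \<open>pdiff i f\<close> and \<open>pdiff i g\<close>, which by
  \<open>pdiff_cong\<close> again agree on \<open>S\<close>; hence the induction over arbitrary
  \<open>f\<close> and \<open>g\<close>.\<close>

lemma Ck_on_cong:
  assumes "open S" "\<And>p. p \<in> S \<Longrightarrow> f p = g p"
  shows "Ck_on k S f = Ck_on k S g"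
  using assms(2)
proof (induction k arbitrary: f g)
  case (0 f g)
  show ?case
    unfolding Ck_on.simps by (rule continuous_on_cong[OF refl 0])
next
  case (Suc k f g)
  have "Ck_on k S (pdiff i f) = Ck_on k S (pdiff i g)" for i
    by (rule Suc.IH) (rule pdiff_cong[OF assms(1) _ Suc.prems])
  moreover have "f differentiable (at p within S) \<longleftrightarrow> g differentiable (at p within S)" if "p \<in> S" for p
    using has_derivative_transform[OF that, of f g] has_derivative_transform[OF that, of g f] Suc.prems
    unfolding differentiable_def by metis
  ultimately show ?case
    by (simp add: differentiable_on_def)
qed

section \<open>Calculus of complex partial derivatives\<close>

lemma has_derivative_Re_cderiv:
  assumes "has_cderiv F D p"
  shows "((\<lambda>q. Re (c * F q)) has_derivative (\<lambda>v. Re (c * (\<Sum>a\<in>UNIV. D a * cplx_coord a v)))) (at p)"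
  using assms unfolding has_cderiv_def
  by (intro has_derivative_Re has_derivative_mult_right)

text \<open>The k-th real direction has a single nonzero complex coordinate, namely
  \<open>cplx_unit k\<close> in slot \<open>cplx_index k\<close>. The result is again the real part
  of a constant times a complex function, so differentiation can be iterated.\<close>

lemma pdiff_Re_cderiv:
  assumes "has_cderiv F D p"
  shows "pdiff k (\<lambda>q. Re (c * F q)) p = Re (c * cplx_unit k * D (cplx_index k))"
proof -
  have "(\<Sum>a\<in>UNIV. D a * cplx_coord a (axis k 1)) = D (cplx_index k) * cplx_unit k"
    by (simp add: cplx_coord_axis if_distrib[of "\<lambda>x. _ * x"] cong: if_cong)
  then show ?thesis
    using pdiff_eqI[OF has_derivative_Re_cderiv[OF assms, of c], of k] by (simp add: mult_ac)
qed

lemma pdiff_Re_cderiv_on: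
  assumes "open S" "p \<in> S" "\<And>q. q \<in> S \<Longrightarrow> f q = Re (c * F q)" "has_cderiv F D p"
  shows "pdiff k f p = Re (c * cplx_unit k * D (cplx_index k))"
  by (rule trans[OF pdiff_cong[OF assms(1-3)] pdiff_Re_cderiv[OF assms(4)]])

lemma has_cderiv_const: "has_cderiv (\<lambda>q. c) (\<lambda>a. 0) p"
  by (simp add: has_cderiv_def)

lemma has_cderiv_coord: "has_cderiv (cplx_coord b) (\<lambda>a. if a = b then 1 else 0) p"
  unfolding has_cderiv_def
  using bounded_linear_imp_has_derivative[OF bounded_linear_cplx_coord]
  by (simp add: if_distrib[of "\<lambda>x. x * _"] cong: if_cong)

lemma has_cderiv_add:
  assumes "has_cderiv F D p" "has_cderiv G E p"
  shows "has_cderiv (\<lambda>q. F q + G q) (\<lambda>a. D a + E a) p"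
  using has_derivative_add[OF assms[unfolded has_cderiv_def]]
  by (simp add: has_cderiv_def sum.distrib distrib_right)

lemma has_cderiv_mult:
  assumes "has_cderiv F D p" "has_cderiv G E p"
  shows "has_cderiv (\<lambda>q. F q * G q) (\<lambda>a. F p * E a + D a * G p) p"
proof -
  have "F p * (\<Sum>a\<in>UNIV. E a * cplx_coord a v) + (\<Sum>a\<in>UNIV. D a * cplx_coord a v) * G p
      = (\<Sum>a\<in>UNIV. (F p * E a + D a * G p) * cplx_coord a v)" for v
    unfolding sum_distrib_left sum_distrib_right sum.distrib[symmetric]
    by (intro sum.cong refl) (simp add: algebra_simps)
  then show ?thesis
    using has_derivative_mult[OF assms[unfolded has_cderiv_def]] by (simp add: has_cderiv_def)
qed

lemma has_cderiv_compose:
  assumes "has_cderiv F D p" "(\<phi> has_field_derivative d) (at (F p))"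
  shows "has_cderiv (\<lambda>q. \<phi> (F q)) (\<lambda>a. d * D a) p"
  using has_derivative_compose[OF assms(1)[unfolded has_cderiv_def]
      assms(2)[unfolded has_field_derivative_def]]
  by (simp add: has_cderiv_def sum_distrib_left mult_ac)

lemma has_cderiv_inverse:
  assumes "has_cderiv F D p" "F p \<noteq> 0"
  shows "has_cderiv (\<lambda>q. inverse (F q)) (\<lambda>a. - (inverse (F p))\<^sup>2 * D a) p"
  using has_cderiv_compose[OF assms(1) DERIV_inverse[OF assms(2)]]
  by (simp add: power2_eq_square)

section \<open>Smoothness of real parts\<close>

text \<open>An algebra of functions that is closed under both complex partial derivatives; this closure
  yields smoothness of all orders at once.\<close>

inductive holo_alg :: "complex set \<Rightarrow> (real^4 \<Rightarrow> complex) \<Rightarrow> bool" for V where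
  base: "\<phi> holomorphic_on V \<Longrightarrow> holo_alg V (\<lambda>p. \<phi> (cplx_coord 1 p))"
| fibre: "holo_alg V (cplx_coord 2)"
| inverse_fibre: "holo_alg V (\<lambda>p. inverse (cplx_coord 2 p))"
| add: "holo_alg V F \<Longrightarrow> holo_alg V G \<Longrightarrow> holo_alg V (\<lambda>p. F p + G p)"
| mult: "holo_alg V F \<Longrightarrow> holo_alg V G \<Longrightarrow> holo_alg V (\<lambda>p. F p * G p)"

lemma holo_alg_const: "holo_alg V (\<lambda>p. c)"
  using base[of "\<lambda>_. c"] by simp

text \<open>Induction on the generation of \<open>F\<close>: \<open>deriv \<phi>\<close> is again
  holomorphic on \<open>V\<close>, the derivative of 1/X is -(1/X)^2, and sums and products follow
  the usual rules. Each \<open>D a\<close> is one function on all of R^4, but it is claimed to be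
  the derivative only where z lies in \<open>V\<close> and X is nonzero.\<close>

lemma holo_alg_has_cderiv:
  assumes "holo_alg V F" "open V"
  shows "\<exists>D. (\<forall>a. holo_alg V (D a)) \<and>
    (\<forall>p. cplx_coord 1 p \<in> V \<and> cplx_coord 2 p \<noteq> 0 \<longrightarrow> has_cderiv F (\<lambda>a. D a p) p)"
  using assms(1)
proof induction
  case (base \<phi>)
  have "has_cderiv (\<lambda>p. \<phi> (cplx_coord 1 p)) (\<lambda>a. deriv \<phi> (cplx_coord 1 p) * (if a = 1 then 1 else 0)) p"
    if "cplx_coord 1 p \<in> V" for p
    using has_cderiv_compose[OF has_cderiv_coord] holomorphic_derivI[OF base assms(2) that] by blast
  moreover have "holo_alg V (\<lambda>p. deriv \<phi> (cplx_coord 1 p) * (if a = 1 then 1 else 0))" for a :: 2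
    by (intro holo_alg.intros holo_alg_const holomorphic_deriv base assms(2))
  ultimately show ?case by (intro exI[of _ "\<lambda>a p. deriv \<phi> (cplx_coord 1 p) * (if a = 1 then 1 else 0)"]) auto
next
  case fibre
  show ?case
    by (intro exI[of _ "\<lambda>a p. if a = 2 then 1 else 0"]) (auto simp: has_cderiv_coord holo_alg_const)
next
  case inverse_fibre
  have "holo_alg V (\<lambda>p. (- 1) * (inverse (cplx_coord 2 p) * inverse (cplx_coord 2 p)) * (if a = 2 then 1 else 0))" for a :: 2
    by (intro holo_alg.intros holo_alg_const)
  then show ?case
    using has_cderiv_inverse[OF has_cderiv_coord, of 2]
    by (intro exI[of _ "\<lambda>a p. (- 1) * (inverse (cplx_coord 2 p) * inverse (cplx_coord 2 p)) * (if a = 2 then 1 else 0)"])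
      (auto simp: power2_eq_square)
next
  case (add F G)
  then obtain D E where "\<forall>a. holo_alg V (D a)" "\<forall>a. holo_alg V (E a)"
    "\<forall>p. cplx_coord 1 p \<in> V \<and> cplx_coord 2 p \<noteq> 0 \<longrightarrow> has_cderiv F (\<lambda>a. D a p) p"
    "\<forall>p. cplx_coord 1 p \<in> V \<and> cplx_coord 2 p \<noteq> 0 \<longrightarrow> has_cderiv G (\<lambda>a. E a p) p"
    by blast
  then show ?case
    by (intro exI[of _ "\<lambda>a p. D a p + E a p"]) (auto intro: has_cderiv_add holo_alg.add)
next
  case (mult F G)
  then obtain D E where D: "\<And>a. holo_alg V (D a)" "\<And>a. holo_alg V (E a)"
    "\<forall>p. cplx_coord 1 p \<in> V \<and> cplx_coord 2 p \<noteq> 0 \<longrightarrow> has_cderiv F (\<lambda>a. D a p) p"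
    "\<forall>p. cplx_coord 1 p \<in> V \<and> cplx_coord 2 p \<noteq> 0 \<longrightarrow> has_cderiv G (\<lambda>a. E a p) p"
    by blast
  have "holo_alg V (\<lambda>p. F p * E a p + D a p * G p)" for a
    by (rule holo_alg.add[OF holo_alg.mult[OF mult.hyps(1) D(2)] holo_alg.mult[OF D(1) mult.hyps(2)]])
  with D(3,4) show ?case
    by (intro exI[of _ "\<lambda>a p. F p * E a p + D a p * G p"]) (auto intro: has_cderiv_mult)
qed

text \<open>A partial derivative of \<open>Re (c * F p)\<close> has the same shape, with
  \<open>c\<close> multiplied by a unit and \<open>F\<close> replaced by another member of the
  algebra. The induction on the order therefore varies both \<open>c\<close> and
  \<open>F\<close>.\<close>

lemma smooth_on_Re_holo_alg:
  assumes "holo_alg V F" "open V" "open S"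
    and S: "\<And>p. p \<in> S \<Longrightarrow> cplx_coord 1 p \<in> V \<and> cplx_coord 2 p \<noteq> 0"
  shows "smooth_on S (\<lambda>p. Re (c * F p))"
proof -
  have "Ck_on k S (\<lambda>p. Re (c * F p))" for k
    using assms(1)
  proof (induction k arbitrary: c F)
    case (0 c F)
    then obtain D where D: "\<And>p. p \<in> S \<Longrightarrow> has_cderiv F (\<lambda>a. D a p) p"
      using holo_alg_has_cderiv[OF _ assms(2)] S by metis
    then have "continuous (at p) (\<lambda>p. Re (c * F p))" if "p \<in> S" for p
      using has_derivative_Re_cderiv has_derivative_continuous that by blast
    then show ?case
      by (simp only: Ck_on.simps) (blast intro: continuous_at_imp_continuous_on)
  next
    case (Suc k c F)
    then obtain D where D: "\<And>p. p \<in> S \<Longrightarrow> has_cderiv F (\<lambda>a. D a p) p" "\<And>a. holo_alg V (D a)"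
      using holo_alg_has_cderiv[OF _ assms(2)] S by metis
    have "(\<lambda>p. Re (c * F p)) differentiable_on S"
      using D(1) has_derivative_Re_cderiv
      by (meson differentiableI differentiable_at_imp_differentiable_on)
    moreover have "Ck_on k S (pdiff i (\<lambda>p. Re (c * F p)))" for i
      using Suc.IH[OF D(2)[of "cplx_index i"], of "c * cplx_unit i"] D(1)
      by (subst Ck_on_cong[OF assms(3) pdiff_Re_cderiv]) auto
    ultimately show ?case by simp
  qed
  then show ?thesis by (simp add: smooth_on_def)
qed


section \<open>Inverse, Christoffel symbols and Ricci tensor of the real part of a complex
  metric\<close>

text \<open>\<open>matrix_inv\<close> is a choice among two-sided inverses. For square matrices a
  left inverse is also a right inverse, and this pins the choice down.\<close>

lemma matrix_inv_eqI:
  fixes A B :: "real^'n^'n"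
  assumes "B ** A = mat 1"
  shows "matrix_inv A = B" and "invertible A"
proof -
  have AB: "A ** B = mat 1"
    using assms matrix_left_right_inverse by blast
  then show "invertible A"
    using assms unfolding invertible_def by blast
  have "\<exists>C. A ** C = mat 1 \<and> C ** A = mat 1"
    using AB assms by blast
  then have "A ** matrix_inv A = mat 1"
    unfolding matrix_inv_def by (rule someI2_ex) blast
  then have "B ** (A ** matrix_inv A) = B"
    by (simp add: matrix_mul_rid)
  then show "matrix_inv A = B"
    by (simp add: matrix_mul_assoc assms)
qed

text \<open>The units have modulus 1, so raising an index replaces its unit by the conjugate; the
  product with \<open>g\<close> then contracts by \<open>Re_contract\<close>.\<close>

lemma Re_metric_inverse:
  assumes g: "\<And>i j. g $ i $ j = Re (cplx_unit i * cplx_unit j * G (cplx_index i) (cplx_index j))"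
    and inv: "\<And>a c. (\<Sum>b\<in>UNIV. K a b * G b c) = (if a = c then 1 else 0)"
  shows "matrix_inv g $ i $ j = Re (cnj (cplx_unit i) * cnj (cplx_unit j) * K (cplx_index i) (cplx_index j))"
    and "invertible g"
proof -
  define M :: "real^4^4" where
    "M = (\<chi> i j. Re (cnj (cplx_unit i) * cnj (cplx_unit j) * K (cplx_index i) (cplx_index j)))"
  have "(M ** g) $ i $ j = mat 1 $ i $ j" for i j
  proof -
    have "(M ** g) $ i $ j = (\<Sum>m\<in>UNIV. Re (cplx_unit j * G (cplx_index m) (cplx_index j) * cplx_unit m)
        * Re (cnj (cplx_unit m) * (cnj (cplx_unit i) * K (cplx_index i) (cplx_index m))))"
      by (simp only: matrix_matrix_mult_def M_def g vec_lambda_beta mult_ac)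
    also have "\<dots> = Re (\<Sum>a\<in>UNIV. cplx_unit j * G a (cplx_index j) * (cnj (cplx_unit i) * K (cplx_index i) a))"
      by (rule Re_contract)
    also have "\<dots> = Re (cnj (cplx_unit i) * cplx_unit j * (\<Sum>a\<in>UNIV. K (cplx_index i) a * G a (cplx_index j)))"
      by (simp only: sum_distrib_left mult_ac)
    \<comment> \<open>For equal complex indices the value is
      \<open>Re (cnj (cplx_unit i) * cplx_unit j)\<close>, and 1 and \<open>\<i>\<close> are
      orthonormal over the reals.\<close>
    also have "\<dots> = mat 1 $ i $ j"
      unfolding inv using exhaust_4[of i] exhaust_4[of j] by (auto simp: mat_def)
    finally show ?thesis .
  qed
  then have "M ** g = mat 1"
    by (simp add: vec_eq_iff)
  from matrix_inv_eqI[OF this] show "invertible g"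
    "matrix_inv g $ i $ j = Re (cnj (cplx_unit i) * cnj (cplx_unit j) * K (cplx_index i) (cplx_index j))"
    by (simp_all add: M_def)
qed

text \<open>The derivatives of \<open>g\<close> contribute the units of the lower indices and the
  inverse metric the conjugate unit of the upper one. Contracting over \<open>l\<close> leaves the
  complex Christoffel formula.\<close>

lemma christoffel_Re_metric:
  assumes "open S" "p \<in> S"
    and g: "\<And>q i j. q \<in> S \<Longrightarrow>
      g q $ i $ j = Re (cplx_unit i * cplx_unit j * G (cplx_index i) (cplx_index j) q)"
    and inv: "\<And>a c. (\<Sum>b\<in>UNIV. K a b * G b c p) = (if a = c then 1 else 0)"
    and D: "\<And>a b. has_cderiv (G a b) (D a b) p"
    and \<Gamma>: "\<And>a b c. \<Gamma> a b c = (1/2) * (\<Sum>l\<in>UNIV. K a l * (D l c b + D l b c - D b c l))"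
  shows "christoffel g i j k p =
    Re (cnj (cplx_unit i) * cplx_unit j * cplx_unit k * \<Gamma> (cplx_index i) (cplx_index j) (cplx_index k))"
proof -
  have d: "pdiff k (\<lambda>q. g q $ i $ j) p
      = Re (cplx_unit i * cplx_unit j * cplx_unit k * D (cplx_index i) (cplx_index j) (cplx_index k))" for i j k
    by (rule pdiff_Re_cderiv_on[OF assms(1,2) g D])
  have half: "(1/2) * Re z = Re ((1/2) * z)" for z
    by simp
  \<comment> \<open>The factors are regrouped so that \<open>cplx_unit l\<close> stands in one real
    part and its conjugate in the other, as \<open>Re_contract\<close> requires.\<close>
  have "christoffel g i j k p = (1/2) * (\<Sum>l\<in>UNIV.
      Re (cplx_unit j * cplx_unit k * (D (cplx_index l) (cplx_index k) (cplx_index j)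
          + D (cplx_index l) (cplx_index j) (cplx_index k)
          - D (cplx_index j) (cplx_index k) (cplx_index l)) * cplx_unit l)
      * Re (cnj (cplx_unit l) * (cnj (cplx_unit i) * K (cplx_index i) (cplx_index l))))"
    unfolding christoffel_def d Re_metric_inverse(1)[OF g[OF assms(2)] inv]
      minus_complex.sel[symmetric] plus_complex.sel[symmetric]
    by (simp only: ring_distribs mult_ac)
  also have "\<dots> = (1/2) * Re (\<Sum>l\<in>UNIV. cplx_unit j * cplx_unit k * (D l (cplx_index k) (cplx_index j)
          + D l (cplx_index j) (cplx_index k) - D (cplx_index j) (cplx_index k) l)
          * (cnj (cplx_unit i) * K (cplx_index i) l))"
    by (subst Re_contract) (rule refl)
  also have "\<dots> = Re ((1/2) * (\<Sum>l\<in>UNIV. cplx_unit j * cplx_unit k * (D l (cplx_index k) (cplx_index j)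
          + D l (cplx_index j) (cplx_index k) - D (cplx_index j) (cplx_index k) l)
          * (cnj (cplx_unit i) * K (cplx_index i) l)))"
    by (rule half)
  also have "\<dots> = Re (cnj (cplx_unit i) * cplx_unit j * cplx_unit k
      * \<Gamma> (cplx_index i) (cplx_index j) (cplx_index k))"
    unfolding \<Gamma> by (simp only: sum_distrib_left mult_ac)
  finally show ?thesis .
qed

text \<open>In the contracted curvature component the units of the traced index cancel, since
  \<open>cnj (cplx_unit k) * cplx_unit k = 1\<close>. The summand depends on \<open>k\<close> only
  through its complex index, and each complex index arises from two real ones: this is the factor
  2.\<close>

lemma ricci_Re_metric:
  assumes "open S" "p \<in> S"
    and chr: "\<And>q i j k. q \<in> S \<Longrightarrow> christoffel g i j k q =
      Re (cnj (cplx_unit i) * cplx_unit j * cplx_unit k * \<Gamma> (cplx_index i) (cplx_index j) (cplx_index k) q)"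
    and D: "\<And>a b c. has_cderiv (\<Gamma> a b c) (D a b c) p"
  shows "ricci g p $ i $ j = 2 * Re (cplx_unit i * cplx_unit j * (\<Sum>a\<in>UNIV.
      D a (cplx_index i) (cplx_index j) a - D a (cplx_index i) a (cplx_index j)
      + (\<Sum>m\<in>UNIV. \<Gamma> a m a p * \<Gamma> m (cplx_index i) (cplx_index j) p)
      - (\<Sum>m\<in>UNIV. \<Gamma> a m (cplx_index j) p * \<Gamma> m (cplx_index i) a p)))"
proof -
  have d: "pdiff l (christoffel g i j k) p = Re (cnj (cplx_unit i) * cplx_unit j * cplx_unit k * cplx_unit l
      * D (cplx_index i) (cplx_index j) (cplx_index k) (cplx_index l))" for i j k l
    by (rule pdiff_Re_cderiv_on[OF assms(1,2) chr D])
  have q: "(\<Sum>m\<in>UNIV. christoffel g i m k p * christoffel g m j l p)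
      = Re (cnj (cplx_unit i) * cplx_unit j * cplx_unit k * cplx_unit l
        * (\<Sum>m\<in>UNIV. \<Gamma> (cplx_index i) m (cplx_index k) p * \<Gamma> m (cplx_index j) (cplx_index l) p))" for i j k l
  proof -
    have "(\<Sum>m\<in>UNIV. christoffel g i m k p * christoffel g m j l p) = (\<Sum>m\<in>UNIV.
        Re (cnj (cplx_unit i) * cplx_unit k * \<Gamma> (cplx_index i) (cplx_index m) (cplx_index k) p * cplx_unit m)
      * Re (cnj (cplx_unit m) * (cplx_unit j * cplx_unit l * \<Gamma> (cplx_index m) (cplx_index j) (cplx_index l) p)))"
      unfolding chr[OF assms(2)] by (simp only: mult_ac)
    also have "\<dots> = Re (\<Sum>m\<in>UNIV. cnj (cplx_unit i) * cplx_unit k * \<Gamma> (cplx_index i) m (cplx_index k) p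
      * (cplx_unit j * cplx_unit l * \<Gamma> m (cplx_index j) (cplx_index l) p))"
      by (rule Re_contract)
    finally show ?thesis
      by (simp only: sum_distrib_left mult_ac)
  qed
  let ?R = "\<lambda>a. D a (cplx_index i) (cplx_index j) a - D a (cplx_index i) a (cplx_index j)
      + (\<Sum>m\<in>UNIV. \<Gamma> a m a p * \<Gamma> m (cplx_index i) (cplx_index j) p)
      - (\<Sum>m\<in>UNIV. \<Gamma> a m (cplx_index j) p * \<Gamma> m (cplx_index i) a p)"
  have "riemann g k i k j p = Re (cplx_unit i * cplx_unit j * ?R (cplx_index k))" for k
  proof -
    have "riemann g k i k j p = Re (cnj (cplx_unit k) * cplx_unit k * (cplx_unit i * cplx_unit j * ?R (cplx_index k)))"
      unfolding riemann_def d q minus_complex.sel[symmetric] plus_complex.sel[symmetric]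
      by (simp only: ring_distribs mult_ac)
    moreover have "cnj (cplx_unit k) * cplx_unit k = 1"
      by (simp add: cplx_unit_def)
    ultimately show ?thesis by (simp only: mult_1_left)
  qed
  then have "ricci g p $ i $ j = (\<Sum>a\<in>UNIV. 2 * Re (cplx_unit i * cplx_unit j * ?R a))"
    using sum_index_pairs[of "\<lambda>a u. Re (cplx_unit i * cplx_unit j * ?R a)"]
    by (simp only: ricci_def vec_lambda_beta mult_2)
  then show ?thesis
    by (simp only: sum_distrib_left Re_sum)
qed

lemma has_cderiv_divide:
  assumes "has_cderiv F D p" "has_cderiv G E p" "G p \<noteq> 0"
  shows "has_cderiv (\<lambda>q. F q / G q) (\<lambda>a. (D a * G p - F p * E a) / (G p)\<^sup>2) p"
proof -
  have "(\<lambda>a. F p * (- (inverse (G p))\<^sup>2 * E a) + D a * inverse (G p))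
      = (\<lambda>a. (D a * G p - F p * E a) / (G p)\<^sup>2)"
    using assms(3) by (intro ext) (simp add: field_simps power2_eq_square)
  then show ?thesis
    using has_cderiv_mult[OF assms(1) has_cderiv_inverse[OF assms(2,3)]]
    by (simp add: divide_inverse)
qed


lemma has_cderiv_holomorphic:
  assumes "\<phi> holomorphic_on V" "open V" "cplx_coord 1 p \<in> V"
  shows "has_cderiv (\<lambda>q. \<phi> (cplx_coord 1 q)) (\<lambda>a. if a = 1 then deriv \<phi> (cplx_coord 1 p) else 0) p"
proof -
  have "(\<lambda>a::2. deriv \<phi> (cplx_coord 1 p) * (if a = 1 then 1 else 0))
      = (\<lambda>a. if a = 1 then deriv \<phi> (cplx_coord 1 p) else 0)"
    by auto
  then show ?thesis
    using has_cderiv_compose[OF has_cderiv_coord holomorphic_derivI[OF assms]] by simp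
qed

lemma has_cderiv_diff:
  assumes "has_cderiv F D p" "has_cderiv G E p"
  shows "has_cderiv (\<lambda>q. F q - G q) (\<lambda>a. D a - E a) p"
  using has_derivative_diff[OF assms[unfolded has_cderiv_def]]
  by (simp add: has_cderiv_def sum_subtractf left_diff_distrib)

lemma has_cderiv_power:
  assumes "has_cderiv F D p"
  shows "has_cderiv (\<lambda>q. F q ^ n) (\<lambda>a. of_nat n * F p ^ (n - 1) * D a) p"
proof -
  have "((\<lambda>z. z ^ n) has_field_derivative of_nat n * F p ^ (n - 1)) (at (F p))"
    by (auto intro!: derivative_eq_intros)
  from has_cderiv_compose[OF assms this] show ?thesis .
qed

text \<open>Lets the calculus rules produce a derivative first and compares it with the desired
  closed form, component by component, afterwards.\<close>

lemma has_cderiv_eq: "has_cderiv F D p \<Longrightarrow> D 1 = E 1 \<Longrightarrow> D 2 = E 2 \<Longrightarrow> has_cderiv F E p"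
  by (simp add: has_cderiv_def sum_2)

section \<open>Explicit connection and curvature of the complex metric\<close>

text \<open>In the definitions below \<open>h'\<close> and \<open>h''\<close> are the values of the derivatives of \<open>h\<close> at \<open>z\<close>; a
  prefix \<open>d_\<close> marks complex partial derivatives, whose direction is the last index. The first
  index of a Christoffel symbol is the upper one.\<close>

definition norden :: "complex \<Rightarrow> complex \<Rightarrow> 2 \<Rightarrow> 2 \<Rightarrow> complex" where
  "norden h X a b = (if a \<noteq> b then 0 else if a = 1 then (h / X - X)\<^sup>2 else 1 / X\<^sup>2)"

definition norden_inverse :: "complex \<Rightarrow> complex \<Rightarrow> 2 \<Rightarrow> 2 \<Rightarrow> complex" where
  "norden_inverse h X a b = (if a \<noteq> b then 0 else if a = 1 then 1 / (h / X - X)\<^sup>2 else X\<^sup>2)"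

definition d_norden :: "complex \<Rightarrow> complex \<Rightarrow> complex \<Rightarrow> 2 \<Rightarrow> 2 \<Rightarrow> 2 \<Rightarrow> complex" where
  "d_norden h h' X a b d =
    (if a \<noteq> b then 0
     else if a = 1 then 2 * (h / X - X) * (if d = 1 then h' / X else - h / X\<^sup>2 - 1)
     else if d = 1 then 0 else - 2 / X ^ 3)"

text \<open>With w = h/X - X, the nonzero symbols with upper index 1 are the z- and X-derivatives of
  log w, and those with upper index 2 are - X^2 w w_X and - 1/X.\<close>

definition norden_christoffel :: "complex \<Rightarrow> complex \<Rightarrow> complex \<Rightarrow> 2 \<Rightarrow> 2 \<Rightarrow> 2 \<Rightarrow> complex" where
  "norden_christoffel h h' X a b c =
    (if a = 1 then
       (if b = 1 \<and> c = 1 then h' / (h - X\<^sup>2)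
        else if b = 2 \<and> c = 2 then 0
        else - (h + X\<^sup>2) / (X * (h - X\<^sup>2)))
     else
       (if b = 1 \<and> c = 1 then h\<^sup>2 / X - X ^ 3
        else if b = 2 \<and> c = 2 then - 1 / X
        else 0))"

definition d_norden_christoffel ::
    "complex \<Rightarrow> complex \<Rightarrow> complex \<Rightarrow> complex \<Rightarrow> 2 \<Rightarrow> 2 \<Rightarrow> 2 \<Rightarrow> 2 \<Rightarrow> complex" where
  "d_norden_christoffel h h' h'' X a b c d =
    (if a = 1 then
       (if b = 1 \<and> c = 1 then
          (if d = 1 then (h'' * (h - X\<^sup>2) - h'\<^sup>2) / (h - X\<^sup>2)\<^sup>2 else 2 * X * h' / (h - X\<^sup>2)\<^sup>2)
        else if b = 2 \<and> c = 2 then 0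
        else (if d = 1 then 2 * X * h' / (h - X\<^sup>2)\<^sup>2
              else (h\<^sup>2 - 4 * X\<^sup>2 * h - X ^ 4) / (X\<^sup>2 * (h - X\<^sup>2)\<^sup>2)))
     else
       (if b = 1 \<and> c = 1 then (if d = 1 then 2 * h * h' / X else - h\<^sup>2 / X\<^sup>2 - 3 * X\<^sup>2)
        else if b = 2 \<and> c = 2 then (if d = 1 then 0 else 1 / X\<^sup>2)
        else 0))"

context
  fixes h X :: complex
  assumes nz: "X \<noteq> 0" "h \<noteq> X\<^sup>2"
begin

text \<open>In terms of \<open>d = h - X\<^sup>2\<close> all denominators are monomials.\<close>

lemma norden_substitution:
  obtains d where "d \<noteq> 0" "h = d + X\<^sup>2" "h / X - X = d / X"
proof
  show "h - X\<^sup>2 \<noteq> 0" "h = (h - X\<^sup>2) + X\<^sup>2" "h / X - X = (h - X\<^sup>2) / X"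
    using nz by (simp_all add: field_simps power2_eq_square)
qed

lemma norden_inverse_norden:
  "(\<Sum>b\<in>UNIV. norden_inverse h X a b * norden h X b c) = (if a = c then 1 else 0)"
proof -
  obtain d where "d \<noteq> 0" "h / X - X = d / X"
    using norden_substitution .
  then show ?thesis
    using nz exhaust_2[of a] exhaust_2[of c]
    by (auto simp: norden_inverse_def norden_def sum_2)
qed

lemma norden_christoffel_eq:
  "norden_christoffel h h' X a b c = (1/2) * (\<Sum>l\<in>UNIV. norden_inverse h X a l *
     (d_norden h h' X l c b + d_norden h h' X l b c - d_norden h h' X b c l))"
proof -
  obtain d where d: "d \<noteq> 0" "h = d + X\<^sup>2" "h / X - X = d / X"
    using norden_substitution .
  show ?thesis
    \<comment> \<open>The quotient \<open>h / X - X\<close> has to be replaced by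
      \<open>d / X\<close> before \<open>h\<close> itself is rewritten, since otherwise it would no
      longer match.\<close>
    unfolding norden_christoffel_def norden_inverse_def d_norden_def d(3) sum_2 unfolding d(2)
    using nz(1) d(1) exhaust_2[of a] exhaust_2[of b] exhaust_2[of c]
    by (elim disjE) (simp_all add: field_simps power2_eq_square power3_eq_cube)
qed

text \<open>This is Ric G = - G for curvature -1, as a rational identity in \<open>X\<close>,
  \<open>d\<close>, \<open>h'\<close> and \<open>h''\<close>. The two cross entries of
  \<open>d_norden_christoffel\<close> with upper index 1 coincide because both are the mixed
  derivative of log (h/X - X).\<close>

lemma norden_ricci:
  "(\<Sum>a\<in>UNIV. d_norden_christoffel h h' h'' X a b c a - d_norden_christoffel h h' h'' X a b a c
      + (\<Sum>m\<in>UNIV. norden_christoffel h h' X a m a * norden_christoffel h h' X m b c)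
      - (\<Sum>m\<in>UNIV. norden_christoffel h h' X a m c * norden_christoffel h h' X m b a))
    = - norden h X b c"
proof -
  obtain d where d: "d \<noteq> 0" "h = d + X\<^sup>2" "h / X - X = d / X"
    using norden_substitution .
  have "b = 1 \<or> b = 2" "c = 1 \<or> c = 2"
    by (rule exhaust_2)+
  then show ?thesis
    unfolding d_norden_christoffel_def norden_christoffel_def norden_def d(3) sum_2 unfolding d(2)
    using nz(1) d(1)
    by (elim disjE)
      (simp_all, simp_all add: field_simps power2_eq_square power3_eq_cube power4_eq_xxxx)
qed

end

text \<open>The values at \<open>p\<close> get names of their own, so that the derivatives can be
  compared as rational expressions in plain variables.\<close>

lemma
  assumes \<phi>: "\<phi> holomorphic_on V" "open V" "cplx_coord 1 p \<in> V"
    and X: "cplx_coord 2 p = X" "X \<noteq> 0"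
    and h: "\<phi> (cplx_coord 1 p) = h" "h \<noteq> X\<^sup>2"
    and h': "deriv \<phi> (cplx_coord 1 p) = h'" and h'': "deriv (deriv \<phi>) (cplx_coord 1 p) = h''"
  shows has_cderiv_norden:
      "has_cderiv (\<lambda>q. norden (\<phi> (cplx_coord 1 q)) (cplx_coord 2 q) a b) (d_norden h h' X a b) p"
    and has_cderiv_norden_christoffel:
      "has_cderiv (\<lambda>q. norden_christoffel (\<phi> (cplx_coord 1 q)) (deriv \<phi> (cplx_coord 1 q)) (cplx_coord 2 q) a b c)
        (d_norden_christoffel h h' h'' X a b c) p"
proof -
  obtain d where d: "d \<noteq> 0" "h = d + X\<^sup>2" "h / X - X = d / X"
    using norden_substitution[OF X(2) h(2)] .
  have eqs: "cplx_coord 2 p = X" "\<phi> (cplx_coord 1 p) = d + X\<^sup>2" "deriv \<phi> (cplx_coord 1 p) = h'"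
    "deriv (deriv \<phi>) (cplx_coord 1 p) = h''" "h = d + X\<^sup>2"
    using assms d by auto
  \<comment> \<open>Nonvanishing of the denominators, in the form in which the quotient rule asks
    for it.\<close>
  have nz: "cplx_coord 2 p \<noteq> 0" "(cplx_coord 2 p)\<^sup>2 \<noteq> 0" "\<phi> (cplx_coord 1 p) - (cplx_coord 2 p)\<^sup>2 \<noteq> 0"
    "cplx_coord 2 p * (\<phi> (cplx_coord 1 p) - (cplx_coord 2 p)\<^sup>2) \<noteq> 0"
    using assms by simp_all
  have d\<phi>: "deriv \<phi> holomorphic_on V"
    by (intro holomorphic_deriv \<phi>)
  note rules = has_cderiv_add has_cderiv_diff has_cderiv_mult has_cderiv_divide
    has_cderiv_power has_cderiv_const has_cderiv_coord
    has_cderiv_holomorphic[OF \<phi>] has_cderiv_holomorphic[OF d\<phi> \<phi>(2,3)] nz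
  have 1: "has_cderiv (\<lambda>p. (\<phi> (cplx_coord 1 p) / cplx_coord 2 p - cplx_coord 2 p)\<^sup>2)
     (\<lambda>d. 2 * (h / X - X) * (if d = 1 then h' / X else - h / X\<^sup>2 - 1)) p"
    by (rule has_cderiv_eq, (rule rules)+)
      (use X d in \<open>simp_all add: eqs field_simps power2_eq_square\<close>)
  have 2: "has_cderiv (\<lambda>p. 1 / (cplx_coord 2 p)\<^sup>2) (\<lambda>d. if d = 1 then 0 else - 2 / X ^ 3) p"
    by (rule has_cderiv_eq, (rule rules)+)
      (use X in \<open>simp_all add: eqs field_simps power2_eq_square power3_eq_cube\<close>)
  show "has_cderiv (\<lambda>q. norden (\<phi> (cplx_coord 1 q)) (cplx_coord 2 q) a b) (d_norden h h' X a b) p"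
    unfolding norden_def[abs_def] d_norden_def[abs_def] using 1 2 has_cderiv_const[of 0 p]
    by (cases "a = b"; cases "a = 1") (simp_all only: if_True if_False simp_thms)
  have 3: "has_cderiv (\<lambda>p. deriv \<phi> (cplx_coord 1 p) / (\<phi> (cplx_coord 1 p) - (cplx_coord 2 p)\<^sup>2))
     (\<lambda>d. if d = 1 then (h'' * (h - X\<^sup>2) - h'\<^sup>2) / (h - X\<^sup>2)\<^sup>2 else 2 * X * h' / (h - X\<^sup>2)\<^sup>2) p"
    by (rule has_cderiv_eq, (rule rules)+)
      (use X d in \<open>simp_all add: eqs power2_eq_square\<close>)
  \<comment> \<open>The sign is written as a factor \<open>- 1\<close> so that the product rule
    covers it; \<open>mult_minus1\<close> restores the form of the definition later.\<close>
  have 4: "has_cderiv (\<lambda>p. - 1 * (\<phi> (cplx_coord 1 p) + (cplx_coord 2 p)\<^sup>2)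
      / (cplx_coord 2 p * (\<phi> (cplx_coord 1 p) - (cplx_coord 2 p)\<^sup>2)))
     (\<lambda>d. if d = 1 then 2 * X * h' / (h - X\<^sup>2)\<^sup>2
        else (h\<^sup>2 - 4 * X\<^sup>2 * h - X ^ 4) / (X\<^sup>2 * (h - X\<^sup>2)\<^sup>2)) p"
    by (rule has_cderiv_eq, (rule rules)+)
      (use X d in \<open>simp_all add: eqs field_simps power2_eq_square power4_eq_xxxx\<close>)
  have 5: "has_cderiv (\<lambda>p. (\<phi> (cplx_coord 1 p))\<^sup>2 / cplx_coord 2 p - cplx_coord 2 p ^ 3)
     (\<lambda>d. if d = 1 then 2 * h * h' / X else - h\<^sup>2 / X\<^sup>2 - 3 * X\<^sup>2) p"
    by (rule has_cderiv_eq, (rule rules)+)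
      (use X d in \<open>simp_all add: eqs field_simps power2_eq_square\<close>)
  have 6: "has_cderiv (\<lambda>p. - 1 / cplx_coord 2 p) (\<lambda>d. if d = 1 then 0 else 1 / X\<^sup>2) p"
    by (rule has_cderiv_eq, (rule rules)+) (use X in \<open>simp_all add: eqs\<close>)
  show "has_cderiv (\<lambda>q. norden_christoffel (\<phi> (cplx_coord 1 q)) (deriv \<phi> (cplx_coord 1 q)) (cplx_coord 2 q) a b c)
        (d_norden_christoffel h h' h'' X a b c) p"
    unfolding norden_christoffel_def[abs_def] d_norden_christoffel_def[abs_def]
    using 3 4[unfolded mult_minus1] 5 6 has_cderiv_const[of 0 p]
    by (cases "a = 1"; cases "b = 1 \<and> c = 1"; cases "b = 2 \<and> c = 2") (simp_all only: if_True if_False simp_thms)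
qed

section \<open>Scalar curvature and the Einstein equation\<close>

text \<open>Contracting the Einstein equation with the inverse metric gives \<eta> times the trace
  of the identity matrix.\<close>

lemma ricci_scalar_einstein:
  fixes g :: "real^'n::finite \<Rightarrow> real^'n^'n"
  assumes "einstein_on S g \<eta>" "p \<in> S"
  shows "ricci_scalar g p = \<eta> * real CARD('n)"
proof -
  have sym: "transpose (g p) = g p" and inv: "invertible (g p)" and ric: "ricci g p = \<eta> *\<^sub>R g p"
    using assms by (auto simp: einstein_on_def pseudo_riemannian_metric_on_def)
  obtain B where "B ** g p = mat 1"
    using inv unfolding invertible_def by blast
  then have 1: "matrix_inv (g p) ** g p = mat 1"
    using matrix_inv_eqI(1) by blast
  \<comment> \<open>The transpose, harmless by symmetry, turns the double contraction into the trace
    of a matrix product.\<close>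
  have "ricci_scalar g p = \<eta> * (\<Sum>i\<in>UNIV. \<Sum>j\<in>UNIV. matrix_inv (g p) $ i $ j * transpose (g p) $ j $ i)"
    by (simp add: ricci_scalar_def ric sum_distrib_left mult_ac transpose_def)
  also have "\<dots> = \<eta> * (\<Sum>i\<in>UNIV. (matrix_inv (g p) ** g p) $ i $ i)"
    by (simp add: sym matrix_matrix_mult_def)
  finally show ?thesis
    by (simp add: 1 mat_def)
qed


lemma einstein_on_norden:
  assumes V: "open V" "\<phi> holomorphic_on V" and S: "open S"
    "\<And>p. p \<in> S \<Longrightarrow> cplx_coord 1 p \<in> V \<and> cplx_coord 2 p \<noteq> 0 \<and> \<phi> (cplx_coord 1 p) \<noteq> (cplx_coord 2 p)\<^sup>2"
    and g: "\<And>q i j. q \<in> S \<Longrightarrow> g q $ i $ j = Re (cplx_unit i * cplx_unit j *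
      norden (\<phi> (cplx_coord 1 q)) (cplx_coord 2 q) (cplx_index i) (cplx_index j))"
  shows "einstein_on S g (-2)"
proof -
  have smooth: "smooth_on S (\<lambda>p. g p $ i $ j)" for i j
  proof -
    \<comment> \<open>This is h/X - X, written with the generators of the algebra; its square is the
      \<open>dz\<close> component.\<close>
    have "holo_alg V (\<lambda>p. \<phi> (cplx_coord 1 p) * inverse (cplx_coord 2 p) + (- 1) * cplx_coord 2 p)"
      by (rule holo_alg.intros holo_alg_const V)+
    from holo_alg.mult[OF this this]
    have 1: "holo_alg V (\<lambda>p. (\<phi> (cplx_coord 1 p) / cplx_coord 2 p - cplx_coord 2 p)\<^sup>2)"
      by (simp add: power2_eq_square divide_inverse)
    have 2: "holo_alg V (\<lambda>p. 1 / (cplx_coord 2 p)\<^sup>2)"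
      using holo_alg.mult[OF holo_alg.inverse_fibre holo_alg.inverse_fibre, of V]
      by (simp add: power2_eq_square divide_inverse)
    have "holo_alg V (\<lambda>p. norden (\<phi> (cplx_coord 1 p)) (cplx_coord 2 p) a b)" for a b
      unfolding norden_def using 1 2 holo_alg_const[of V 0]
      by (cases "a = b"; cases "a = 1") (simp_all only: if_True if_False simp_thms)
    then have "smooth_on S (\<lambda>p. Re (cplx_unit i * cplx_unit j *
        norden (\<phi> (cplx_coord 1 p)) (cplx_coord 2 p) (cplx_index i) (cplx_index j)))"
      using S(2) by (intro smooth_on_Re_holo_alg[OF _ V(1) S(1)]) auto
    then show ?thesis
      unfolding smooth_on_def using Ck_on_cong[OF S(1) g] by simp
  qed
  have metric: "pseudo_riemannian_metric_on S g"
    unfolding pseudo_riemannian_metric_on_def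
  proof (intro conjI ballI allI)
    fix p assume p: "p \<in> S"
    have "g p $ j $ i = g p $ i $ j" for i j
      unfolding g[OF p] by (auto simp: norden_def mult.commute)
    then show "transpose (g p) = g p"
      by (simp add: vec_eq_iff transpose_def)
    show "invertible (g p)"
      using S(2)[OF p] by (intro Re_metric_inverse(2)[OF g[OF p] norden_inverse_norden]) auto
  qed (use S smooth in auto)
  have chr: "christoffel g i j k p = Re (cnj (cplx_unit i) * cplx_unit j * cplx_unit k *
      norden_christoffel (\<phi> (cplx_coord 1 p)) (deriv \<phi> (cplx_coord 1 p)) (cplx_coord 2 p)
        (cplx_index i) (cplx_index j) (cplx_index k))" if p: "p \<in> S" for p i j k
    by (rule christoffel_Re_metric[OF S(1) p g norden_inverse_norden
          has_cderiv_norden[OF V(2,1) _ refl _ refl _ refl refl] norden_christoffel_eq])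
      (use S(2)[OF p] in auto)
  have "ricci g p $ i $ j = ((-2) *\<^sub>R g p) $ i $ j" if p: "p \<in> S" for p i j
  proof -
    note * = S(2)[OF p, THEN conjunct1] S(2)[OF p, THEN conjunct2, THEN conjunct1]
      S(2)[OF p, THEN conjunct2, THEN conjunct2]
    have "ricci g p $ i $ j = 2 * Re (cplx_unit i * cplx_unit j *
        - norden (\<phi> (cplx_coord 1 p)) (cplx_coord 2 p) (cplx_index i) (cplx_index j))"
      by (rule trans[OF ricci_Re_metric[OF S(1) p chr
            has_cderiv_norden_christoffel[OF V(2,1) *(1) refl *(2) refl *(3) refl refl]]])
        (simp_all only: norden_ricci[OF *(2,3)])
    \<comment> \<open>The constant -2 is the doubling of the trace times the -1 of Ric G = -
      G.\<close>
    also have "\<dots> = -2 * g p $ i $ j"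
      unfolding g[OF p] by (simp only: mult_minus_right uminus_complex.sel mult_minus_left)
    finally show ?thesis by simp
  qed
  then show ?thesis
    using metric by (simp add: einstein_on_def vec_eq_iff)
qed

section \<open>From the Cauchy-Riemann equations to a holomorphic function\<close>

lemma linear_real2:
  fixes f :: "real^2 \<Rightarrow> real"
  assumes "linear f"
  shows "f v = v $ 1 * f (axis 1 1) + v $ 2 * f (axis 2 1)"
proof -
  have "v = v $ 1 *\<^sub>R axis 1 1 + v $ 2 *\<^sub>R axis 2 1"
    by (simp add: vec_eq_iff forall_2 axis_def)
  then have "f v = f (v $ 1 *\<^sub>R axis 1 1 + v $ 2 *\<^sub>R axis 2 1)"
    by simp
  then show ?thesis
    by (simp add: linear_add[OF assms] linear_cmul[OF assms])
qed

lemma bounded_linear_vector_Re_Im: "bounded_linear (\<lambda>z. vector [Re z, Im z] :: real^2)"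
  by (intro linear_conv_bounded_linear[THEN iffD1] linearI) (auto simp: vec_eq_iff forall_2)

text \<open>Total differentiability supplies a real-linear derivative, and the Cauchy-Riemann
  equations make it multiplication by the complex number u_x + i v_x.\<close>

lemma holomorphic_on_Cauchy_Riemann:
  fixes u v :: "real^2 \<Rightarrow> real"
  assumes "open U" and diff: "u differentiable_on U" "v differentiable_on U"
    and CR: "\<And>q. q \<in> U \<Longrightarrow> pdiff 1 u q = pdiff 2 v q" "\<And>q. q \<in> U \<Longrightarrow> pdiff 2 u q = - pdiff 1 v q"
  shows "(\<lambda>z. Complex (u (vector [Re z, Im z])) (v (vector [Re z, Im z])))
    holomorphic_on {z. vector [Re z, Im z] \<in> U}"
proof -
  let ?w = "\<lambda>z. vector [Re z, Im z] :: real^2"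
  have "((\<lambda>z. Complex (u (?w z)) (v (?w z))) has_field_derivative
      Complex (pdiff 1 u (?w z)) (pdiff 1 v (?w z))) (at z)" if z: "?w z \<in> U" for z
  proof -
    have "u differentiable (at (?w z))" "v differentiable (at (?w z))"
      using diff z \<open>open U\<close> by (simp_all add: differentiable_on_eq_differentiable_at)
    then obtain u' v' where u': "(u has_derivative u') (at (?w z))" and v': "(v has_derivative v') (at (?w z))"
      unfolding differentiable_def by blast
    have w: "(?w has_derivative ?w) (at z)"
      by (rule bounded_linear_imp_has_derivative[OF bounded_linear_vector_Re_Im])
    have "((\<lambda>z. of_real (u (?w z)) + \<i> * of_real (v (?w z))) has_derivative
        (\<lambda>d. of_real (u' (?w d)) + \<i> * of_real (v' (?w d)))) (at z)"
      by (intro has_derivative_add has_derivative_mult_right has_derivative_of_real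
          has_derivative_compose[OF w u'] has_derivative_compose[OF w v'])
    moreover have "u' d = d $ 1 * pdiff 1 u (?w z) - d $ 2 * pdiff 1 v (?w z)"
      "v' d = d $ 1 * pdiff 1 v (?w z) + d $ 2 * pdiff 1 u (?w z)" for d
      using linear_real2[OF has_derivative_linear[OF u'], of d]
        linear_real2[OF has_derivative_linear[OF v'], of d]
        pdiff_eqI[OF u'] pdiff_eqI[OF v'] CR[OF z] by simp_all
    then have "(\<lambda>d. of_real (u' (?w d)) + \<i> * of_real (v' (?w d)))
        = (*) (Complex (pdiff 1 u (?w z)) (pdiff 1 v (?w z)))"
      by (intro ext) (simp add: complex_eq_iff mult.commute)
    ultimately show ?thesis
      by (simp add: has_field_derivative_def Complex_eq)
  qed
  then show ?thesis
    by (auto simp: holomorphic_on_def field_differentiable_def intro: has_field_derivative_at_within)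
qed

section \<open>The explicit metric as a real part\<close>

text \<open>With W = h/X - X, the unit products 1, \<open>\<i>\<close> and -1 turn W^2 into the
  entries Re W^2, - Im W^2 and - Re W^2 of the (x, y) block; 1/X^2 does the same for (\<Phi>,
  \<Psi>). The coefficient of dx dy is - 2 Im W^2, which \<open>symprod\<close> spreads over two
  entries.\<close>

lemma g_KN_eq_Re_norden:
  assumes "Complex (p $ 2) (p $ 4) \<noteq> 0"
  shows "g_KN u v p $ i $ j = Re (cplx_unit i * cplx_unit j *
    norden (Complex (u (base_point p)) (v (base_point p))) (cplx_coord 2 p) (cplx_index i) (cplx_index j))"
proof -
  define s t a b where "s = p $ 2" and "t = p $ 4" and "a = u (base_point p)" and "b = v (base_point p)"
  note st = s_def[symmetric] t_def[symmetric] a_def[symmetric] b_def[symmetric]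
  define D where "D = s\<^sup>2 + t\<^sup>2"
  have D: "D \<noteq> 0"
    using assms by (simp add: D_def s_def t_def complex_eq_iff sum_power2_eq_zero_iff)
  define W where "W = Complex a b / Complex s t - Complex s t"
  have W: "Re W = (a * s + b * t - s * D) / D" "Im W = (b * s - a * t - t * D) / D"
    using D by (simp_all add: W_def D_def Re_divide Im_divide diff_divide_distrib)
  define Q where "Q = 1 / (Complex s t)\<^sup>2"
  \<comment> \<open>This says |X^2|^2 = |X|^4; it brings the denominator of 1/X^2 to the power of
    \<open>D\<close> used in the metric.\<close>
  have "(s\<^sup>2 - t\<^sup>2)\<^sup>2 + (2 * s * t)\<^sup>2 = D\<^sup>2"
    unfolding D_def by algebra
  then have Q: "Re Q = (s\<^sup>2 - t\<^sup>2) / D\<^sup>2" "Im Q = - (2 * s * t) / D\<^sup>2"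
    by (simp_all add: Q_def Re_divide Im_divide Re_power2 Im_power2)
  have A: "Re (W\<^sup>2) = ((s\<^sup>2 - t\<^sup>2) * (D\<^sup>2 + a\<^sup>2 - b\<^sup>2) + 4 * s * t * a * b - 2 * D\<^sup>2 * a) / D\<^sup>2"
    "Im (W\<^sup>2) = 2 * ((s * b - t * (D + a)) * (t * b - s * (D - a))) / D\<^sup>2"
  proof -
    have "Re (W\<^sup>2) = ((a * s + b * t - s * D)\<^sup>2 - (b * s - a * t - t * D)\<^sup>2) / D\<^sup>2"
      by (simp only: Re_power2 W power_divide diff_divide_distrib[symmetric])
    also have "(a * s + b * t - s * D)\<^sup>2 - (b * s - a * t - t * D)\<^sup>2
        = (s\<^sup>2 - t\<^sup>2) * (D\<^sup>2 + a\<^sup>2 - b\<^sup>2) + 4 * s * t * a * b - 2 * D\<^sup>2 * a"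
      unfolding D_def by algebra
    finally show "Re (W\<^sup>2) = ((s\<^sup>2 - t\<^sup>2) * (D\<^sup>2 + a\<^sup>2 - b\<^sup>2) + 4 * s * t * a * b - 2 * D\<^sup>2 * a) / D\<^sup>2" .
    show "Im (W\<^sup>2) = 2 * ((s * b - t * (D + a)) * (t * b - s * (D - a))) / D\<^sup>2"
      by (simp add: Im_power2 W power2_eq_square) (simp add: algebra_simps)
  qed
  show ?thesis
    unfolding g_KN_def Let_def norden_def cplx_coord_def st D_def[symmetric]
    using exhaust_4[of i] exhaust_4[of j]
    by (elim disjE)
      (simp_all add: symprod_def axis_def W_def[symmetric] Q_def[symmetric] A Q,
       simp_all add: diff_divide_distrib)
qed

theorem lemma10:
  fixes U :: "(real^2) set" and hRe hIm :: "real^2 \<Rightarrow> real"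
  assumes "open U"
    and "hRe differentiable_on U" and "hIm differentiable_on U"
    and "\<And>q. q \<in> U \<Longrightarrow> pdiff 1 hRe q = pdiff 2 hIm q"
    and "\<And>q. q \<in> U \<Longrightarrow> pdiff 2 hRe q = - pdiff 1 hIm q"
  shows "einstein_on (H_KN U hRe hIm) (g_KN hRe hIm) (-2)
    \<and> (\<forall>p\<in>H_KN U hRe hIm. ricci_scalar (g_KN hRe hIm) p = -8)"
proof -
  let ?S = "H_KN U hRe hIm"
  define V where "V = {z. vector [Re z, Im z] \<in> U}"
  define \<phi> where "\<phi> = (\<lambda>z. Complex (hRe (vector [Re z, Im z])) (hIm (vector [Re z, Im z])))"
  have hol: "\<phi> holomorphic_on V"
    unfolding \<phi>_def V_def by (rule holomorphic_on_Cauchy_Riemann[OF assms])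
  have "open ((\<lambda>z. vector [Re z, Im z]) -` U)"
    using assms(1) by (intro continuous_open_vimage)
      (auto intro: linear_continuous_at bounded_linear_vector_Re_Im)
  then have V: "open V"
    by (simp add: V_def vimage_def)
  have base: "base_point p = vector [Re (cplx_coord 1 p), Im (cplx_coord 1 p)]" for p
    by (simp add: base_point_def cplx_coord_def)
  have S_eq: "?S = {p. cplx_coord 1 p \<in> V \<and> cplx_coord 2 p \<noteq> 0 \<and> \<phi> (cplx_coord 1 p) \<noteq> (cplx_coord 2 p)\<^sup>2}"
    by (simp add: H_KN_def V_def \<phi>_def base) (simp add: cplx_coord_def)
  have cont: "continuous_on T (cplx_coord a)" for T a
    by (intro linear_continuous_on bounded_linear_cplx_coord)
  have "open (cplx_coord 1 -` V)"
    using V cont by (intro open_vimage) auto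
  moreover have "continuous_on (cplx_coord 1 -` V) (\<lambda>p. \<phi> (cplx_coord 1 p))"
    by (rule continuous_on_compose2[OF holomorphic_on_imp_continuous_on[OF hol] cont]) auto
  \<comment> \<open>The conditions that X is nonzero and h differs from X^2 are merged into the
    nonvanishing of one function, continuous on the open set where z lies in
    \<open>V\<close>.\<close>
  then have "continuous_on (cplx_coord 1 -` V)
      (\<lambda>p. cplx_coord 2 p * (\<phi> (cplx_coord 1 p) - (cplx_coord 2 p)\<^sup>2))"
    by (intro continuous_intros cont)
  ultimately have "open (cplx_coord 1 -` V \<inter>
      (\<lambda>p. cplx_coord 2 p * (\<phi> (cplx_coord 1 p) - (cplx_coord 2 p)\<^sup>2)) -` (- {0}))"
    by (intro continuous_open_preimage) auto
  also have "\<dots> = ?S"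
    by (auto simp: S_eq)
  finally have S: "open ?S" .
  have E: "einstein_on ?S (g_KN hRe hIm) (-2)"
  proof (rule einstein_on_norden[OF V hol S])
    show "g_KN hRe hIm q $ i $ j = Re (cplx_unit i * cplx_unit j *
        norden (\<phi> (cplx_coord 1 q)) (cplx_coord 2 q) (cplx_index i) (cplx_index j))" if "q \<in> ?S" for q i j
      unfolding \<phi>_def base[symmetric] by (rule g_KN_eq_Re_norden) (use that in \<open>simp add: H_KN_def\<close>)
  qed (simp add: S_eq)
  then show ?thesis
    using ricci_scalar_einstein[OF E] by simp
qed

end
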